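(* Let $(M_n,S_n)_{n\ge 0}$ be a Markov random walk whose driving chain $(M_n)_{n\ge0}$ is positive recurrent with at most countable state space $\mathcal S$, transition matrix $P=(p_{ij})_{i,j\in\mathcal S}$ and stationary distribution $\pi=(\pi_i)_{i\in\mathcal S}$. Suppose that the dual walk is positive divergent, i.e. $\lim_{n\to\infty}{}^{\#}S_n=\infty$ a.s. Let $c:=\mathbb P_\xi(\sigma_0=0)$, let $\pi_i^{>}:=\frac1c\,\mathbb P_\xi(M_0=i,\sigma_0=0)$ for $i\in\mathcal S$ (the stationary distribution of the ladder chain), and let $\mathcal S^{>}:=\{i\in\mathcal S:\pi_i^{>}>0\}$. Then $$\pi_i^{>}=\frac1c\,\pi_i\,\mathbb P_i\big({}^{\#}\sigma^{\leqslant}=\infty\big)=\frac1c\,\mathbb P_\pi\big({}^{\#}M_0^{\leqslant}=i,\,{}^{\#}\sigma^{\leqslant}=\infty\big)\quad\text{for all }i\in\mathcal S,$$ so that $$c=\mathbb P_\pi\big({}^{\#}\sigma^{\leqslant}=\infty\big)\qquad\text{and}\qquad \mathcal S^{>}=\big\{i\in\mathcal S:\mathbb P_i({}^{\#}\sigma^{\leqslant}=\infty)>0\big\}.$$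
   Context: Setting. $(M_n)_{n\ge 0}$ is an irreducible Markov chain on the at most countable set $\mathcal S$ with transition matrix $P=(p_{ij})$; it is positive recurrent, $\pi$ is its unique stationary distribution, and all $\pi_i>0$. $(X_n)_{n\ge1}$ are real random variables, conditionally independent given $(M_n)_{n\ge0}$, with the conditional law of $X_n$ given $(M_k)_{k\ge0}$ equal to $F_{M_{n-1},M_n}$, where $(F_{ij})_{i,j\in\mathcal S}$ are given probability laws on $\mathbb R$. With $S_0:=0$, $S_n:=\sum_{k=1}^nX_k$, the process $(M_n,S_n)_{n\ge0}$ is called a Markov random walk with driving chain $(M_n)_{n\ge0}$. Write $\mathbb P_i=\mathbb P(\cdot\mid M_0=i)$ and $\mathbb P_\lambda=\sum_i\lambda_i\mathbb P_i$ for a measure $\lambda$ on $\mathcal S$. "A.s." means $\mathbb P_i$-a.s. for all $i\in\mathcal S$. Two-sided stationary version. Under $\mathbb P_\xi$, $(M_n,X_n)_{n\in\mathbb Z}$ is the doubly infinite stationary version of this Markov chain, $\xi$ being its stationary law on $\mathcal S\times\mathbb R$; so each $M_n$ has law $\pi$. Put $S_0=0$, $S_n=\sum_{k=1}^nX_k$ for $n\ge1$, $S_n=-\sum_{k=n+1}^0X_k$ for $n\le-1$. Let $\sigma_0:=\sup\{k\le0:S_k>\sup_{j<k}S_j\}$. Dual. ${}^{\#}M_n:=M_{-n}$, ${}^{\#}X_n:=X_{-n+1}$, ${}^{\#}S_n:=-S_{-n}$. The dual sequence $({}^{\#}M_n,{}^{\#}X_n)$ is a Markov chain with transition kernel ${}^{\#}Q((i,x),\{j\}\times(-\infty,t])=\frac{\pi_jp_{ji}}{\pi_i}F_{ji}(t)$,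 and $({}^{\#}M_n,{}^{\#}S_n)_{n\ge0}$ is the corresponding Markov random walk; under $\mathbb P_i$ it starts at ${}^{\#}M_0=M_0=i$, ${}^{\#}S_0=0$. Its weakly descending ladder epochs are ${}^{\#}\sigma_0^{\leqslant}:=0$, ${}^{\#}\sigma_n^{\leqslant}:=\inf\{k>{}^{\#}\sigma_{n-1}^{\leqslant}:{}^{\#}S_k\le{}^{\#}S_{{}^{\#}\sigma_{n-1}^{\leqslant}}\}$ for $n\ge1$ with $\inf\emptyset:=\infty$, and ${}^{\#}\sigma^{\leqslant}:={}^{\#}\sigma_1^{\leqslant}$. Further ${}^{\#}M_n^{\leqslant}:={}^{\#}M_{{}^{\#}\sigma_n^{\leqslant}}$, so ${}^{\#}M_0^{\leqslant}={}^{\#}M_0$. Ladder chain. $M_n^{>}:=M_{\sigma_n^{>}}$, where $\sigma_0^{>}:=0$ and $\sigma_n^{>}:=\inf\{k>\sigma_{n-1}^{>}:S_k>S_{\sigma_{n-1}^{>}}\}$ for $n\ge1$. *)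

theory Defs
  imports "HOL-Probability.Probability"
begin

section \<open>The driving chain\<close>

text \<open>
  The state space is the countable type \<open>'s\<close>. A transition matrix is given by its rows
  \<open>P i :: 's pmf\<close>, so that \<open>p\<^sub>i\<^sub>j = pmf (P i) j\<close>.
\<close>

definition irreducible_chain :: "('s \<Rightarrow> 's pmf) \<Rightarrow> bool" where
  "irreducible_chain P \<longleftrightarrow>
     (\<forall>i j. \<exists>n. pmf (((\<lambda>\<mu>. bind_pmf \<mu> P) ^^ n) (return_pmf i)) j > 0)"

text \<open>
  \<open>first_passage P j n i\<close> is the probability that the chain started at \<open>i\<close> visits \<open>j\<close> at time
  \<open>n\<close> for the first time after time \<open>0\<close>.
\<close>

primrec first_passage :: "('s \<Rightarrow> 's pmf) \<Rightarrow> 's \<Rightarrow> nat \<Rightarrow> 's \<Rightarrow> real" where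
  "first_passage P j 0 i = 0"
| "first_passage P j (Suc n) i =
     (if n = 0 then pmf (P i) j
      else (\<Sum>\<^sub>\<infinity>k\<in>- {j}. pmf (P i) k * first_passage P j n k))"

definition positive_recurrent_chain :: "('s \<Rightarrow> 's pmf) \<Rightarrow> bool" where
  "positive_recurrent_chain P \<longleftrightarrow>
     (\<forall>i. (\<lambda>n. first_passage P i n i) sums 1 \<and>
          summable (\<lambda>n. real n * first_passage P i n i))"

definition stationary_distribution :: "('s \<Rightarrow> 's pmf) \<Rightarrow> 's pmf \<Rightarrow> bool" where
  "stationary_distribution P \<pi> \<longleftrightarrow> bind_pmf \<pi> P = \<pi>"

text \<open>Elementary Markov property of a discrete process with transition matrix \<open>P\<close>.\<close>

definition markov_chain :: "('s \<Rightarrow> 's pmf) \<Rightarrow> 'w measure \<Rightarrow> (nat \<Rightarrow> 'w \<Rightarrow> 's) \<Rightarrow> bool" where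
  "markov_chain P N M \<longleftrightarrow>
     (\<forall>n. M n \<in> measurable N (count_space UNIV)) \<and>
     (\<forall>n h j. \<P>(\<omega> in N. \<forall>k\<le>n. M k \<omega> = h k) \<noteq> 0 \<longrightarrow>
        \<P>(\<omega> in N. M (Suc n) \<omega> = j \<bar> \<forall>k\<le>n. M k \<omega> = h k) = pmf (P (h n)) j)"


section \<open>Markov random walks\<close>

definition sigma_generated ::
    "'w measure \<Rightarrow> 'e measure \<Rightarrow> ('t \<Rightarrow> 'w \<Rightarrow> 'e) \<Rightarrow> 'w measure" where
  "sigma_generated N E Z = vimage_algebra (space N) (\<lambda>\<omega> t. Z t \<omega>) (\<Pi>\<^sub>M t\<in>UNIV. E)"

definition cond_prob_given ::
    "'w measure \<Rightarrow> 'w measure \<Rightarrow> ('w \<Rightarrow> bool) \<Rightarrow> 'w \<Rightarrow> real" where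
  "cond_prob_given N G A = real_cond_exp N G (indicator {\<omega> \<in> space N. A \<omega>})"

definition cond_indep_given ::
    "'w measure \<Rightarrow> 'w measure \<Rightarrow> ('t \<Rightarrow> 'w \<Rightarrow> real) \<Rightarrow> 't set \<Rightarrow> bool" where
  "cond_indep_given N G X I \<longleftrightarrow>
     (\<forall>J B. finite J \<and> J \<subseteq> I \<and> (\<forall>t\<in>J. B t \<in> sets borel) \<longrightarrow>
        (AE \<omega> in N. cond_prob_given N G (\<lambda>\<omega>. \<forall>t\<in>J. X t \<omega> \<in> B t) \<omega> =
                    (\<Prod>t\<in>J. cond_prob_given N G (\<lambda>\<omega>. X t \<omega> \<in> B t) \<omega>)))"

text \<open>
  The random walk is represented by its increments \<open>X 1, X 2, \<dots>\<close>; the value \<open>X 0\<close> is irrelevant.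
\<close>

definition markov_random_walk ::
    "('s \<Rightarrow> 's pmf) \<Rightarrow> ('s \<Rightarrow> 's \<Rightarrow> real measure) \<Rightarrow> 'w measure
      \<Rightarrow> (nat \<Rightarrow> 'w \<Rightarrow> 's) \<Rightarrow> (nat \<Rightarrow> 'w \<Rightarrow> real) \<Rightarrow> bool" where
  "markov_random_walk P F N M X \<longleftrightarrow>
     prob_space N \<and> markov_chain P N M \<and>
     (\<forall>n\<ge>1. X n \<in> borel_measurable N) \<and>
     (let G = sigma_generated N (count_space UNIV) M in
        cond_indep_given N G X {1..} \<and>
        (\<forall>n\<ge>1. \<forall>B\<in>sets borel.
           AE \<omega> in N. cond_prob_given N G (\<lambda>\<omega>. X n \<omega> \<in> B) \<omega> =
                       measure (F (M (n - 1) \<omega>) (M n \<omega>)) B))"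

definition stationary_process ::
    "'w measure \<Rightarrow> 'e measure \<Rightarrow> (int \<Rightarrow> 'w \<Rightarrow> 'e) \<Rightarrow> bool" where
  "stationary_process N E Z \<longleftrightarrow>
     (\<forall>n. Z n \<in> measurable N E) \<and>
     (\<forall>m. distr N (\<Pi>\<^sub>M n\<in>UNIV. E) (\<lambda>\<omega> n. Z (n + m) \<omega>) =
          distr N (\<Pi>\<^sub>M n\<in>UNIV. E) (\<lambda>\<omega> n. Z n \<omega>))"

text \<open>
  Doubly infinite stationary version: a stationary process indexed by the integers whose
  restriction to nonnegative times is a Markov random walk with parameters \<open>P\<close> and \<open>F\<close>. The
  measure \<open>N\<close> plays the role of \<open>\<P>\<^sub>\<xi>\<close>, where \<open>\<xi>\<close> is the law of \<open>(M 0, X 0)\<close> under \<open>N\<close>.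
\<close>

definition stationary_mrw ::
    "('s \<Rightarrow> 's pmf) \<Rightarrow> ('s \<Rightarrow> 's \<Rightarrow> real measure) \<Rightarrow> 'w measure
      \<Rightarrow> (int \<Rightarrow> 'w \<Rightarrow> 's) \<Rightarrow> (int \<Rightarrow> 'w \<Rightarrow> real) \<Rightarrow> bool" where
  "stationary_mrw P F N M X \<longleftrightarrow>
     stationary_process N (count_space UNIV \<Otimes>\<^sub>M borel) (\<lambda>n \<omega>. (M n \<omega>, X n \<omega>)) \<and>
     markov_random_walk P F N (\<lambda>n. M (int n)) (\<lambda>n. X (int n))"

text \<open>\<open>\<P>\<^sub>i = \<P>(\<cdot> | M\<^sub>0 = i)\<close> and \<open>\<P>\<^sub>\<lambda> = \<Sum>\<^sub>i \<lambda>\<^sub>i \<P>\<^sub>i\<close>.\<close>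

definition prob_from :: "'w measure \<Rightarrow> (int \<Rightarrow> 'w \<Rightarrow> 's) \<Rightarrow> 's \<Rightarrow> 'w measure" where
  "prob_from N M i = uniform_measure N {\<omega> \<in> space N. M 0 \<omega> = i}"

definition prob_init ::
    "'w measure \<Rightarrow> (int \<Rightarrow> 'w \<Rightarrow> 's) \<Rightarrow> 's pmf \<Rightarrow> ('w \<Rightarrow> bool) \<Rightarrow> real" where
  "prob_init N M l A = (\<Sum>\<^sub>\<infinity>i. pmf l i * \<P>(\<omega> in prob_from N M i. A \<omega>))"

definition walk :: "(int \<Rightarrow> 'w \<Rightarrow> real) \<Rightarrow> int \<Rightarrow> 'w \<Rightarrow> real" where
  "walk X n \<omega> = (if n \<ge> 0 then (\<Sum>k=1..n. X k \<omega>) else - (\<Sum>k=n+1..0. X k \<omega>))"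

text \<open>
  Both suprema are taken in the extended reals: the inner one may be infinite, and the outer
  one is \<open>-\<infinity>\<close> if there is no record time.
\<close>

definition sigma_zero :: "(int \<Rightarrow> 'w \<Rightarrow> real) \<Rightarrow> 'w \<Rightarrow> ereal" where
  "sigma_zero X \<omega> =
     (SUP k \<in> {k. k \<le> 0 \<and> ereal (walk X k \<omega>) > (SUP j \<in> {..<k}. ereal (walk X j \<omega>))}.
        ereal (real_of_int k))"


section \<open>The dual walk and its weakly descending ladder epochs\<close>

definition dual_chain :: "(int \<Rightarrow> 'w \<Rightarrow> 's) \<Rightarrow> int \<Rightarrow> 'w \<Rightarrow> 's" where
  "dual_chain M n = M (- n)"

definition dual_walk :: "(int \<Rightarrow> 'w \<Rightarrow> real) \<Rightarrow> int \<Rightarrow> 'w \<Rightarrow> real" where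
  "dual_walk X n \<omega> = - walk X (- n) \<omega>"

text \<open>
  If the \<open>n\<close>-th epoch is \<open>\<infinity>\<close>, the set below is empty and the next epoch is
  \<open>Inf {} = \<infinity>\<close> as well; \<open>the_enat\<close> is therefore only relevant at finite epochs.
\<close>

primrec weak_desc_epoch :: "(int \<Rightarrow> 'w \<Rightarrow> real) \<Rightarrow> nat \<Rightarrow> 'w \<Rightarrow> enat" where
  "weak_desc_epoch S 0 \<omega> = 0"
| "weak_desc_epoch S (Suc n) \<omega> =
     Inf {enat k | k. enat k > weak_desc_epoch S n \<omega> \<and>
            S (int k) \<omega> \<le> S (int (the_enat (weak_desc_epoch S n \<omega>))) \<omega>}"

definition dual_epoch :: "(int \<Rightarrow> 'w \<Rightarrow> real) \<Rightarrow> nat \<Rightarrow> 'w \<Rightarrow> enat" where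
  "dual_epoch X n = weak_desc_epoch (dual_walk X) n"

text \<open>The dual chain sampled at the ladder epochs; meaningful only where the epoch is finite.\<close>

definition dual_ladder_chain ::
    "(int \<Rightarrow> 'w \<Rightarrow> 's) \<Rightarrow> (int \<Rightarrow> 'w \<Rightarrow> real) \<Rightarrow> nat \<Rightarrow> 'w \<Rightarrow> 's" where
  "dual_ladder_chain M X n \<omega> = dual_chain M (int (the_enat (dual_epoch X n \<omega>))) \<omega>"

definition dual_positive_divergent ::
    "'w measure \<Rightarrow> (int \<Rightarrow> 'w \<Rightarrow> 's) \<Rightarrow> (int \<Rightarrow> 'w \<Rightarrow> real) \<Rightarrow> bool" where
  "dual_positive_divergent N M X \<longleftrightarrow>
     (\<forall>i. AE \<omega> in prob_from N M i.
        filterlim (\<lambda>n. dual_walk X (int n) \<omega>) at_top sequentially)"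


section \<open>The constant \<open>c\<close> and the law \<open>\<pi>\<^sup>>\<close>\<close>

definition ladder_const :: "'w measure \<Rightarrow> (int \<Rightarrow> 'w \<Rightarrow> real) \<Rightarrow> real" where
  "ladder_const N X = \<P>(\<omega> in N. sigma_zero X \<omega> = 0)"

definition ladder_law ::
    "'w measure \<Rightarrow> (int \<Rightarrow> 'w \<Rightarrow> 's) \<Rightarrow> (int \<Rightarrow> 'w \<Rightarrow> real) \<Rightarrow> 's \<Rightarrow> real" where
  "ladder_law N M X i =
     1 / ladder_const N X * \<P>(\<omega> in N. M 0 \<omega> = i \<and> sigma_zero X \<omega> = 0)"

end

theory Submission
  imports Defs
begin

text \<open>
  Divergence of the dual walk means that the walk tends to minus infinity in the past, so that the
  supremum over negative times is attained. Hence time 0 is a strict record exactly if the dual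
  walk stays strictly positive after time 0, i.e. if its first weakly descending ladder epoch is
  infinite. Conditioning on the state at time 0, whose law is \<open>\<pi>\<close> because the stationary law of an
  irreducible chain is unique, gives the formulas.
\<close>

section \<open>Positivity and uniqueness of the stationary law\<close>

text \<open>By induction every \<open>n\<close>-step law started in \<open>A\<close> is supported in
  \<open>A\<close>, while irreducibility puts each \<open>j\<close> into one of these supports. It
  is applied below to the support of a law and to the set where one law exceeds a minimum of
  two.\<close>

lemma irreducible_closed_set:
  assumes "irreducible_chain P"
    and "i \<in> A"
    and closed: "\<And>i j. i \<in> A \<Longrightarrow> pmf (P i) j > 0 \<Longrightarrow> j \<in> A"
  shows "j \<in> A"
proof -
  obtain n where n: "pmf (((\<lambda>\<mu>. bind_pmf \<mu> P) ^^ n) (return_pmf i)) j > 0"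
    using assms(1) unfolding irreducible_chain_def by blast
  have "set_pmf (((\<lambda>\<mu>. bind_pmf \<mu> P) ^^ n) (return_pmf i)) \<subseteq> A"
  proof (induction n)
    case 0
    then show ?case using assms(2) by simp
  next
    case (Suc n)
    then show ?case using closed by (fastforce simp: set_pmf_iff pmf_positive_iff)
  qed
  with n show ?thesis by (auto simp: pmf_positive_iff)
qed

lemma stationary_distribution_nn_integral:
  assumes "stationary_distribution P \<pi>"
  shows "ennreal (pmf \<pi> j) = (\<integral>\<^sup>+i. ennreal (pmf \<pi> i) * ennreal (pmf (P i) j) \<partial>count_space UNIV)"
proof -
  have "ennreal (pmf \<pi> j) = ennreal (pmf (bind_pmf \<pi> P) j)"
    using assms by (simp add: stationary_distribution_def)
  then show ?thesis
    by (simp add: ennreal_pmf_bind nn_integral_measure_pmf)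
qed

text \<open>The support of \<pi> is nonempty and closed under transitions. Positivity later ensures
  that conditioning on \<open>M 0 \<omega> = i\<close> is never conditioning on a null
  event.\<close>

lemma stationary_distribution_pos:
  assumes "irreducible_chain P" "stationary_distribution P \<pi>"
  shows "pmf \<pi> j > 0"
proof -
  obtain i where "i \<in> set_pmf \<pi>"
    using set_pmf_not_empty by fast
  then have "j \<in> set_pmf \<pi>"
  proof (rule irreducible_closed_set[OF assms(1)])
    fix i j assume "i \<in> set_pmf \<pi>" "pmf (P i) j > 0"
    then have "j \<in> set_pmf (bind_pmf \<pi> P)"
      by (auto simp: pmf_positive_iff)
    then show "j \<in> set_pmf \<pi>"
      using assms(2) unfolding stationary_distribution_def by metis
  qed
  then show ?thesis by (simp add: pmf_positive_iff)
qed

text \<open>Every point has positive counting measure, so a strict inequality at a single point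
  survives summation as long as the smaller sum is finite.\<close>

lemma nn_integral_count_space_strict_mono:
  fixes f g :: "'a \<Rightarrow> ennreal"
  assumes "(\<integral>\<^sup>+x. f x \<partial>count_space UNIV) \<noteq> \<infinity>" "\<And>x. f x \<le> g x" "f i < g i"
  shows "(\<integral>\<^sup>+x. f x \<partial>count_space UNIV) < (\<integral>\<^sup>+x. g x \<partial>count_space UNIV)"
  using assms by (intro nn_integral_less) (auto simp: AE_count_space not_le)

text \<open>Conservation of mass: exchange the sums (Tonelli) and use that each row of
  \<open>P\<close> sums to 1.\<close>

lemma nn_integral_pmf_transition:
  fixes P :: "'s::countable \<Rightarrow> 's pmf" and g :: "'s \<Rightarrow> ennreal"
  shows "(\<integral>\<^sup>+j. (\<integral>\<^sup>+i. g i * ennreal (pmf (P i) j) \<partial>count_space UNIV) \<partial>count_space UNIV) =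
         (\<integral>\<^sup>+i. g i \<partial>count_space UNIV)"
proof -
  have "(\<integral>\<^sup>+j. (\<integral>\<^sup>+i. g i * ennreal (pmf (P i) j) \<partial>count_space UNIV) \<partial>count_space UNIV) =
        (\<integral>\<^sup>+i. (\<integral>\<^sup>+j. g i * ennreal (pmf (P i) j) \<partial>count_space UNIV) \<partial>count_space UNIV)"
    using nn_integral_fst_count_space[of "\<lambda>(j, i). g i * ennreal (pmf (P i) j)"]
      nn_integral_snd_count_space[of "\<lambda>(j, i). g i * ennreal (pmf (P i) j)"]
    by simp
  also have "\<dots> = (\<integral>\<^sup>+i. g i \<partial>count_space UNIV)"
    by (simp add: nn_integral_cmult nn_integral_pmf measure_pmf.emeasure_space_1[simplified])
  finally show ?thesis .
qed

text \<open>
  The pointwise minimum of two stationary laws is subinvariant, hence invariant because the total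
  mass is preserved. Each of the laws therefore exceeds the minimum nowhere or everywhere.
\<close>

lemma stationary_distribution_unique:
  fixes P :: "'s::countable \<Rightarrow> 's pmf"
  assumes irr: "irreducible_chain P"
    and st: "stationary_distribution P \<mu>" "stationary_distribution P \<pi>"
  shows "\<mu> = \<pi>"
proof -
  define g :: "'s \<Rightarrow> ennreal" where "g i = min (ennreal (pmf \<mu> i)) (ennreal (pmf \<pi> i))" for i
  \<comment> \<open>\<open>T\<close> is the action of \<open>P\<close> on row vectors; with values
    in \<open>ennreal\<close> no summability has to be tracked.\<close>
  define T where "T h j = (\<integral>\<^sup>+i. h i * ennreal (pmf (P i) j) \<partial>count_space UNIV)"
    for h :: "'s \<Rightarrow> ennreal" and j
  have T_pmf: "T (\<lambda>i. ennreal (pmf \<rho> i)) j = ennreal (pmf \<rho> j)"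
    if "stationary_distribution P \<rho>" for \<rho> j
    unfolding T_def by (rule stationary_distribution_nn_integral[OF that, symmetric])
  have g_le: "g i \<le> ennreal (pmf \<mu> i)" "g i \<le> ennreal (pmf \<pi> i)" for i
    by (auto simp: g_def)
  have T_mono: "T g j \<le> T h j" if "\<And>i. g i \<le> h i" for h j
    unfolding T_def by (intro nn_integral_mono mult_right_mono that) auto
  \<comment> \<open>By monotonicity \<open>T g\<close> lies below the images of both laws, which are
    the laws themselves, hence below their minimum.\<close>
  have T_le: "T g j \<le> g j" for j
    using T_mono[OF g_le(1), of j] T_mono[OF g_le(2), of j]
    by (simp add: T_pmf st) (simp add: g_def)
  have fin: "(\<integral>\<^sup>+i. g i \<partial>count_space UNIV) \<noteq> \<infinity>"
  proof -
    have "(\<integral>\<^sup>+i. g i \<partial>count_space UNIV) \<le> (\<integral>\<^sup>+i. ennreal (pmf \<mu> i) \<partial>count_space UNIV)"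
      by (intro nn_integral_mono g_le)
    also have "\<dots> = 1"
      by (simp add: nn_integral_pmf measure_pmf.emeasure_space_1[simplified])
    finally show ?thesis by (auto simp: top_unique)
  qed
  \<comment> \<open>A strict drop at one point would make the total mass of \<open>T g\<close>
    smaller than that of \<open>g\<close>, but \<open>T\<close> preserves mass.\<close>
  have T_g: "T g j = g j" for j
  proof (rule ccontr)
    assume "T g j \<noteq> g j"
    then have "(\<integral>\<^sup>+j. T g j \<partial>count_space UNIV) < (\<integral>\<^sup>+i. g i \<partial>count_space UNIV)"
      using T_le fin
      by (intro nn_integral_count_space_strict_mono[of _ _ j])
         (auto simp: T_def nn_integral_pmf_transition less_le)
    then show False
      by (simp add: T_def nn_integral_pmf_transition)
  qed
  \<comment> \<open>The excess set is closed under transitions: a strict excess at \<open>i\<close>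
    survives \<open>T\<close> at every \<open>j\<close> reachable in one step, and both
    \<open>g\<close> and \<rho> are fixed by \<open>T\<close>.\<close>
  have propagate: "g j < ennreal (pmf \<rho> j)"
    if \<rho>: "stationary_distribution P \<rho>" "\<And>i. g i \<le> ennreal (pmf \<rho> i)"
      and i: "g i < ennreal (pmf \<rho> i)" for \<rho> i j
  proof -
    have "j \<in> {i. g i < ennreal (pmf \<rho> i)}"
    proof (rule irreducible_closed_set[OF irr, of i])
      fix i j assume ij: "i \<in> {i. g i < ennreal (pmf \<rho> i)}" "pmf (P i) j > 0"
      have "T g j < T (\<lambda>i. ennreal (pmf \<rho> i)) j"
        unfolding T_def
      proof (rule nn_integral_count_space_strict_mono[of _ _ i])
        show "(\<integral>\<^sup>+i. g i * ennreal (pmf (P i) j) \<partial>count_space UNIV) \<noteq> \<infinity>"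
          using T_g[of j] g_le(1)[of j] by (auto simp: T_def top_unique)
        show "g i * ennreal (pmf (P i) j) < ennreal (pmf \<rho> i) * ennreal (pmf (P i) j)"
          using ij by (intro ennreal_mult_strict_right_mono) auto
        show "g i * ennreal (pmf (P i) j) \<le> ennreal (pmf \<rho> i) * ennreal (pmf (P i) j)" for i
          by (intro mult_right_mono \<rho>) auto
      qed
      then show "j \<in> {i. g i < ennreal (pmf \<rho> i)}"
        by (simp add: T_g T_pmf \<rho>)
    qed (use i in simp)
    then show ?thesis by simp
  qed
  \<comment> \<open>Both laws have mass 1, so pointwise domination leaves no room for a strict
    inequality.\<close>
  have eqI: "\<rho> = \<rho>'" if "\<And>i. pmf \<rho> i \<le> pmf \<rho>' i" for \<rho> \<rho>' :: "'s pmf"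
  proof (rule pmf_eqI, rule ccontr)
    fix i assume "pmf \<rho> i \<noteq> pmf \<rho>' i"
    then have "(\<integral>\<^sup>+i. ennreal (pmf \<rho> i) \<partial>count_space UNIV) < (\<integral>\<^sup>+i. ennreal (pmf \<rho>' i) \<partial>count_space UNIV)"
      using that[of i]
      by (intro nn_integral_count_space_strict_mono[of _ _ i] ennreal_leI that)
         (simp_all add: nn_integral_pmf measure_pmf.emeasure_space_1[simplified] ennreal_less_iff)
    then show False
      by (simp add: nn_integral_pmf measure_pmf.emeasure_space_1[simplified])
  qed
  show ?thesis
  \<comment> \<open>If \<mu> exceeds the minimum somewhere, it does so everywhere, and the minimum
    is \<pi>. Otherwise the minimum is \<mu>. Either way one law dominates the other.\<close>
  proof (cases "\<exists>i. g i < ennreal (pmf \<mu> i)")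
    case True
    then have less: "g j < ennreal (pmf \<mu> j)" for j
      using propagate[OF st(1) g_le(1)] by blast
    have "pmf \<pi> j \<le> pmf \<mu> j" for j
      using less[of j] by (auto simp: g_def min_def ennreal_less_iff split: if_splits)
    then show ?thesis
      using eqI by metis
  next
    case False
    then have "pmf \<mu> i \<le> pmf \<pi> i" for i
      by (metis ennreal_le_iff g_le(2) not_le order_trans pmf_nonneg)
    then show ?thesis by (rule eqI)
  qed
qed

text \<open>This is where \<pi> enters, since \<open>stationary_mrw\<close> does not mention it:
  equality of the laws at times 0 and 1 makes the initial law stationary, and uniqueness identifies
  it.\<close>

lemma markov_chain_initial_stationary:
  fixes P :: "'s::countable \<Rightarrow> 's pmf"
  assumes N: "prob_space N"
    and irr: "irreducible_chain P"
    and st: "stationary_distribution P \<pi>"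
    and mc: "markov_chain P N M"
    and inv: "distr N (count_space UNIV) (M 1) = distr N (count_space UNIV) (M 0)"
  shows "measure N {\<omega> \<in> space N. M 0 \<omega> = i} = pmf \<pi> i"
proof -
  interpret prob_space N by fact
  have [measurable]: "M n \<in> measurable N (count_space UNIV)" for n
    using mc by (simp add: markov_chain_def)
  define D where "D = distr N (count_space UNIV) (M 0)"
  have meas_D: "measure D {i} = measure N {\<omega> \<in> space N. M 0 \<omega> = i}" for i
    unfolding D_def by (subst measure_distr) (auto intro!: arg_cong[where f = "measure N"])
  have meas_D1: "measure D {i} = measure N {\<omega> \<in> space N. M 1 \<omega> = i}" for i
    unfolding D_def inv[symmetric]
    by (subst measure_distr) (auto intro!: arg_cong[where f = "measure N"])
  interpret D: prob_space D
    unfolding D_def by (rule prob_space_distr) simp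
  have sets_D: "sets D = UNIV"
    by (simp add: D_def)
  \<comment> \<open>A law on a countable type is carried by its atoms, which is what
    \<open>Abs_pmf\<close> requires.\<close>
  have "AE x in D. measure D {x} \<noteq> 0"
    by (subst D.AE_support_countable) (auto simp: sets_D intro!: exI[of _ UNIV])
  then have "D \<in> {M. prob_space M \<and> sets M = UNIV \<and> (AE x in M. measure M {x} \<noteq> 0)}"
    using D.prob_space_axioms sets_D by simp
  then have D_pmf: "measure_pmf (Abs_pmf D) = D"
    by (simp add: Abs_pmf_inverse)
  then have pmf_D: "pmf (Abs_pmf D) i = measure D {i}" for i
    by (simp add: pmf.rep_eq)
  \<comment> \<open>Null states are treated separately because \<open>markov_chain\<close> speaks
    only of histories of positive probability.\<close>
  have step: "measure N {\<omega> \<in> space N. M 1 \<omega> = j \<and> M 0 \<omega> = i} = measure D {i} * pmf (P i) j" for i j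
  proof (cases "measure D {i} = 0")
    case True
    have "measure N {\<omega> \<in> space N. M 1 \<omega> = j \<and> M 0 \<omega> = i} \<le> measure N {\<omega> \<in> space N. M 0 \<omega> = i}"
      by (intro finite_measure_mono) auto
    with True show ?thesis
      using meas_D[of i] by (simp add: measure_le_0_iff)
  next
    case False
    have "\<P>(\<omega> in N. M (Suc 0) \<omega> = j \<bar> \<forall>k\<le>0. M k \<omega> = (\<lambda>_. i) k) = pmf (P ((\<lambda>_. i) 0)) j"
      by (rule mc[unfolded markov_chain_def, THEN conjunct2, rule_format]) (use False meas_D[of i] in simp)
    then show ?thesis
      using False meas_D[of i] by (simp add: cond_prob_def field_simps)
  qed
  have "bind_pmf (Abs_pmf D) P = Abs_pmf D"
  proof (rule pmf_eqI)
    fix j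
    have "ennreal (pmf (Abs_pmf D) j) = emeasure N {\<omega> \<in> space N. M 1 \<omega> = j}"
      by (simp add: pmf_D meas_D1 emeasure_eq_measure)
    also have "{\<omega> \<in> space N. M 1 \<omega> = j} = (\<Union>i. {\<omega> \<in> space N. M 1 \<omega> = j \<and> M 0 \<omega> = i})"
      by auto
    also have "emeasure N \<dots> = (\<integral>\<^sup>+i. emeasure N {\<omega> \<in> space N. M 1 \<omega> = j \<and> M 0 \<omega> = i} \<partial>count_space UNIV)"
      by (intro emeasure_UN_countable) (auto simp: disjoint_family_on_def)
    also have "\<dots> = (\<integral>\<^sup>+i. ennreal (pmf (Abs_pmf D) i) * ennreal (pmf (P i) j) \<partial>count_space UNIV)"
      by (simp add: emeasure_eq_measure step[unfolded One_nat_def] pmf_D ennreal_mult)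
    also have "\<dots> = ennreal (pmf (bind_pmf (Abs_pmf D) P) j)"
      by (simp add: ennreal_pmf_bind nn_integral_measure_pmf)
    finally show "pmf (bind_pmf (Abs_pmf D) P) j = pmf (Abs_pmf D) j"
      by simp
  qed
  then have "Abs_pmf D = \<pi>"
    by (intro stationary_distribution_unique[OF irr _ st]) (simp add: stationary_distribution_def)
  then show ?thesis
    using pmf_D[of i] meas_D[of i] by simp
qed

section \<open>Path properties of the dual walk and the record at time 0\<close>

text \<open>Divergence makes all sublevel sets finite, so the global minimum is attained and there
  is a last time at which it is attained; that time is the witness.\<close>

lemma ex_strict_minimum_of_future:
  fixes f :: "nat \<Rightarrow> real"
  assumes "filterlim f at_top sequentially"
  shows "\<exists>n. \<forall>k>n. f k > f n"
proof -
  have fin: "finite {k. f k \<le> a}" for a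
  proof -
    have "eventually (\<lambda>k. f k > a) sequentially"
      using assms by (simp add: filterlim_at_top_dense)
    then obtain K where "\<And>k. k \<ge> K \<Longrightarrow> f k > a"
      by (auto simp: eventually_sequentially)
    then have "{k. f k \<le> a} \<subseteq> {..<K}"
      by (force simp flip: not_less)
    then show ?thesis
      by (rule finite_subset) simp
  qed
  define m where "m = Min (f ` {k. f k \<le> f 0})"
  have "m \<in> f ` {k. f k \<le> f 0}"
    unfolding m_def by (intro Min_in finite_imageI fin) auto
  then have "{k. f k \<le> m} \<noteq> {}" by auto
  then have n: "Max {k. f k \<le> m} \<in> {k. f k \<le> m}"
    by (intro Max_in fin)
  have "f k > f (Max {k. f k \<le> m})" if "k > Max {k. f k \<le> m}" for k
  proof -
    have "f k > m"
      using Max_ge[OF fin, of k m] that by fastforce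
    with n show ?thesis by simp
  qed
  then show ?thesis by blast
qed

lemma dual_walk_int: "dual_walk X (int k) \<omega> = (\<Sum>j\<in>{1 - int k..0}. X j \<omega>)"
  by (cases k) (auto simp: dual_walk_def walk_def intro!: sum.cong)

text \<open>The increments of the dual walk after time \<open>n\<close> are the same functional as
  those after time 0, evaluated on the path shifted by \<open>- n\<close>. This makes stationarity
  applicable.\<close>

lemma dual_walk_shift:
  "dual_walk X (int (n + k)) \<omega> - dual_walk X (int n) \<omega> = (\<Sum>j\<in>{1 - int k..0}. X (j - int n) \<omega>)"
proof -
  have "{1 - int (n + k)..0} = {1 - int (n + k)..- int n} \<union> {1 - int n..0}"
    by auto
  then have "(\<Sum>j\<in>{1 - int (n + k)..0}. X j \<omega>) =
      (\<Sum>j\<in>{1 - int (n + k)..- int n}. X j \<omega>) + (\<Sum>j\<in>{1 - int n..0}. X j \<omega>)"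
    by (simp add: sum.union_disjoint)
  moreover have "(\<Sum>j\<in>{1 - int (n + k)..- int n}. X j \<omega>) = (\<Sum>j\<in>{1 - int k..0}. X (j - int n) \<omega>)"
    by (rule sum.reindex_bij_witness[of _ "\<lambda>j. j - int n" "\<lambda>j. j + int n"]) auto
  ultimately show ?thesis
    by (simp only: dual_walk_int)
qed

lemma dual_epoch_1_eq_infinity_iff:
  "dual_epoch X 1 \<omega> = \<infinity> \<longleftrightarrow> (\<forall>k>0. dual_walk X (int k) \<omega> > 0)"
proof -
  have "dual_walk X 0 \<omega> = 0"
    by (simp add: dual_walk_def walk_def)
  then have "dual_epoch X 1 \<omega> = Inf (enat ` {k. k > 0 \<and> dual_walk X (int k) \<omega> \<le> 0})"
    by (auto simp: dual_epoch_def zero_enat_def intro!: arg_cong[where f = Inf])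
  also have "\<dots> = \<infinity> \<longleftrightarrow> {k. k > 0 \<and> dual_walk X (int k) \<omega> \<le> 0} = {}"
    unfolding top_enat_def[symmetric] Inf_top_conv by (auto simp: top_enat_def)
  also have "\<dots> \<longleftrightarrow> (\<forall>k>0. dual_walk X (int k) \<omega> > 0)"
    unfolding Collect_empty_eq not_le[symmetric] by blast
  finally show ?thesis .
qed

lemma sigma_zero_eq_0_iff:
  "sigma_zero X \<omega> = 0 \<longleftrightarrow> (SUP j\<in>{..<0}. ereal (walk X j \<omega>)) < 0"
proof -
  let ?R = "{k. k \<le> 0 \<and> ereal (walk X k \<omega>) > (SUP j \<in> {..<k}. ereal (walk X j \<omega>))}"
  have "sigma_zero X \<omega> = 0 \<longleftrightarrow> 0 \<in> ?R"
  proof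
    assume *: "sigma_zero X \<omega> = 0"
    show "0 \<in> ?R"
    proof (rule ccontr)
      assume no: "0 \<notin> ?R"
      \<comment> \<open>Record times are integers: if 0 is not one, all are at most -1, and so is
        their supremum, even when there are none.\<close>
      have "sigma_zero X \<omega> \<le> ereal (- 1)"
        unfolding sigma_zero_def
      proof (rule SUP_least)
        fix k assume "k \<in> ?R"
        then have "k \<le> - 1"
          using no by (cases "k = 0") auto
        then have "real_of_int k \<le> - 1" by linarith
        then show "ereal (real_of_int k) \<le> ereal (- 1)" by simp
      qed
      with * show False by simp
    qed
  next
    assume "0 \<in> ?R"
    then show "sigma_zero X \<omega> = 0"
      unfolding sigma_zero_def
      by (intro antisym SUP_least SUP_upper2[of 0]) auto
  qed
  also have "\<dots> \<longleftrightarrow> (SUP j\<in>{..<0}. ereal (walk X j \<omega>)) < 0"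
    by (simp add: walk_def[of X 0] flip: zero_ereal_def)
  finally show ?thesis .
qed

text \<open>The forward direction holds on every path. The converse needs divergence: positive
  values of the dual walk could otherwise have infimum 0, and the past supremum would then equal 0
  instead of lying below it.\<close>

lemma sigma_zero_eq_0_iff_dual_epoch:
  assumes "filterlim (\<lambda>n. dual_walk X (int n) \<omega>) at_top sequentially"
  shows "sigma_zero X \<omega> = 0 \<longleftrightarrow> dual_epoch X 1 \<omega> = \<infinity>"
proof
  assume "sigma_zero X \<omega> = 0"
  then have sup: "(SUP j\<in>{..<0}. ereal (walk X j \<omega>)) < 0"
    by (simp add: sigma_zero_eq_0_iff)
  have "dual_walk X (int k) \<omega> > 0" if "k > 0" for k
  proof -
    have "ereal (walk X (- int k) \<omega>) \<le> (SUP j\<in>{..<0}. ereal (walk X j \<omega>))"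
      using that by (intro SUP_upper) auto
    with sup have "ereal (walk X (- int k) \<omega>) < 0" by (rule le_less_trans[rotated])
    then show ?thesis by (simp add: dual_walk_def)
  qed
  then show "dual_epoch X 1 \<omega> = \<infinity>"
    unfolding dual_epoch_1_eq_infinity_iff by blast
next
  assume "dual_epoch X 1 \<omega> = \<infinity>"
  then have pos: "dual_walk X (int k) \<omega> > 0" if "k > 0" for k
    using that unfolding dual_epoch_1_eq_infinity_iff by blast
  have "filterlim (\<lambda>n. dual_walk X (int (Suc n)) \<omega>) at_top sequentially"
    using assms by (rule filterlim_compose) (rule filterlim_Suc)
  then obtain K where K: "\<And>n. n \<ge> K \<Longrightarrow> dual_walk X (int (Suc n)) \<omega> \<ge> 1"
    by (auto simp: filterlim_at_top eventually_sequentially)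
  \<comment> \<open>A positive lower bound for the dual walk at positive times: finitely many
    positive values before \<open>K\<close>, and the bound 1 from \<open>K\<close> on.
    \<open>Suc\<close> skips time 0, where the walk vanishes.\<close>
  define m where "m = Min (insert 1 ((\<lambda>n. dual_walk X (int (Suc n)) \<omega>) ` {..<K}))"
  have "m > 0"
    unfolding m_def using pos by (subst Min_gr_iff) (auto simp del: of_nat_Suc)
  have m_le: "m \<le> dual_walk X (int (Suc n)) \<omega>" for n
  proof (cases "n < K")
    case True
    then show ?thesis unfolding m_def by (intro Min_le) auto
  next
    case False
    have "m \<le> 1" unfolding m_def by (intro Min_le) auto
    also have "1 \<le> dual_walk X (int (Suc n)) \<omega>" using False K by simp
    finally show ?thesis .
  qed
  have "(SUP j\<in>{..<0}. ereal (walk X j \<omega>)) \<le> ereal (- m)"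
  proof (rule SUP_least)
    fix j :: int assume "j \<in> {..<0}"
    then obtain n where "j = - int (Suc n)"
      by (metis lessThan_iff neg_less_0_iff_less add.inverse_inverse zero_less_imp_eq_int gr0_implies_Suc)
    then show "ereal (walk X j \<omega>) \<le> ereal (- m)"
      using m_le[of n] by (simp add: dual_walk_def)
  qed
  also have "\<dots> < 0" using \<open>m > 0\<close> by simp
  finally show "sigma_zero X \<omega> = 0"
    by (simp add: sigma_zero_eq_0_iff)
qed

section \<open>Shift invariance and positivity of the ladder constant\<close>

lemma stationary_process_prob_shift:
  assumes st: "stationary_process N E Z"
    and B: "B \<in> sets (\<Pi>\<^sub>M n\<in>UNIV. E)"
  shows "measure N {\<omega> \<in> space N. (\<lambda>n. Z (n + m) \<omega>) \<in> B} = measure N {\<omega> \<in> space N. (\<lambda>n. Z n \<omega>) \<in> B}"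
proof -
  have [measurable]: "Z n \<in> measurable N E" for n
    using st by (simp add: stationary_process_def)
  have *: "measure (distr N (\<Pi>\<^sub>M n\<in>UNIV. E) (\<lambda>\<omega> n. Z (n + m) \<omega>)) B =
      measure N {\<omega> \<in> space N. (\<lambda>n. Z (n + m) \<omega>) \<in> B}" for m
    by (subst measure_distr) (use B in \<open>auto intro!: measurable_PiM_single' arg_cong[where f = "measure N"]
        simp: space_PiM PiE_def extensional_def dest: measurable_space[OF \<open>\<And>n. Z n \<in> measurable N E\<close>]\<close>)
  show ?thesis
    using *[of m] *[of 0] st by (simp add: stationary_process_def)
qed

text \<open>
  Almost every dual path has a time after which it stays strictly above its value at that time; by
  stationarity, time 0 is as likely to have this property as any other.
\<close>

lemma prob_dual_epoch_infinity_pos: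
  fixes M :: "int \<Rightarrow> 'w \<Rightarrow> 's"
  assumes N: "prob_space N"
    and st: "stationary_process N (count_space UNIV \<Otimes>\<^sub>M borel) (\<lambda>n \<omega>. (M n \<omega>, X n \<omega>))"
    and div: "AE \<omega> in N. filterlim (\<lambda>n. dual_walk X (int n) \<omega>) at_top sequentially"
  shows "measure N {\<omega> \<in> space N. dual_epoch X 1 \<omega> = \<infinity>} > 0"
proof -
  interpret prob_space N by fact
  have Z: "(\<lambda>\<omega>. (M n \<omega>, X n \<omega>)) \<in> measurable N (count_space UNIV \<Otimes>\<^sub>M borel)" for n
    using st by (simp add: stationary_process_def)
  have [measurable]: "X n \<in> borel_measurable N" for n
    using measurable_compose[OF Z[of n] measurable_snd] by simp
  have [measurable]: "dual_walk X (int k) \<in> borel_measurable N" for k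
    by (subst dual_walk_int[abs_def]) simp
  define A where "A n = {\<omega> \<in> space N. \<forall>k>0. dual_walk X (int (n + k)) \<omega> > dual_walk X (int n) \<omega>}" for n
  have A_sets: "A n \<in> sets N" for n
    unfolding A_def by measurable
  let ?E = "count_space UNIV \<Otimes>\<^sub>M borel :: ('s \<times> real) measure"
  \<comment> \<open>A fixed event in path space; \<open>A n\<close> says that the path shifted by
    \<open>- n\<close> lies in \<open>B\<close>, so all \<open>A n\<close> have the same
    probability.\<close>
  define B where "B = {z \<in> space (\<Pi>\<^sub>M n\<in>(UNIV::int set). ?E). \<forall>k>0::nat. (\<Sum>j\<in>{1 - int k..0}. snd (z j)) > 0}"
  have B: "B \<in> sets (\<Pi>\<^sub>M n\<in>UNIV. ?E)"
    unfolding B_def by measurable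
  have A_eq: "A n = {\<omega> \<in> space N. (\<lambda>j. (M (j + - int n) \<omega>, X (j + - int n) \<omega>)) \<in> B}" for n
  proof -
    have "dual_walk X (int (n + k)) \<omega> > dual_walk X (int n) \<omega> \<longleftrightarrow>
        (\<Sum>j\<in>{1 - int k..0}. X (j + - int n) \<omega>) > 0" for k \<omega>
      using dual_walk_shift[of X n k \<omega>] by auto
    then show ?thesis
      unfolding A_def B_def by (simp add: space_PiM space_pair_measure)
  qed
  have A_const: "measure N (A n) = measure N (A 0)" for n
    using stationary_process_prob_shift[OF st B, of "- int n"] stationary_process_prob_shift[OF st B, of "- int 0"]
    by (simp only: A_eq)
  have A_0: "A 0 = {\<omega> \<in> space N. dual_epoch X 1 \<omega> = \<infinity>}"
    unfolding A_def dual_epoch_1_eq_infinity_iff by (simp add: dual_walk_int[of X 0, simplified])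
  \<comment> \<open>Otherwise all \<open>A n\<close> would be null, and so would their countable
    union, which contains almost every path.\<close>
  have "measure N (A 0) \<noteq> 0"
  proof
    assume "measure N (A 0) = 0"
    then have "AE \<omega> in N. \<omega> \<notin> A n" for n
      using A_const[of n] A_sets[of n] by (intro AE_not_in) (simp add: null_sets_def emeasure_eq_measure)
    then have "AE \<omega> in N. \<forall>n. \<omega> \<notin> A n"
      by (simp add: AE_all_countable)
    then have "AE \<omega> in N. False"
      using div AE_space
    proof eventually_elim
      case (elim \<omega>)
      then obtain n where "\<forall>k>n. dual_walk X (int k) \<omega> > dual_walk X (int n) \<omega>"
        using ex_strict_minimum_of_future by blast
      with elim have "\<omega> \<in> A n" by (simp add: A_def del: of_nat_add)
      with elim show False by blast
    qed
    then show False by simp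
  qed
  then show ?thesis
    unfolding A_0 by (simp add: zero_less_measure_iff)
qed

section \<open>Decomposition according to the state at time 0\<close>

theorem corollary2p4:
  fixes P :: "'s::countable \<Rightarrow> 's pmf"
    and \<pi> :: "'s pmf"
    and F :: "'s \<Rightarrow> 's \<Rightarrow> real measure"
    and N :: "'w measure"
    and M :: "int \<Rightarrow> 'w \<Rightarrow> 's"
    and X :: "int \<Rightarrow> 'w \<Rightarrow> real"
  assumes "irreducible_chain P"
    and "positive_recurrent_chain P"
    and "stationary_distribution P \<pi>"
    and "\<And>i j. real_distribution (F i j)"
    and "stationary_mrw P F N M X"
    and "dual_positive_divergent N M X"
  shows "ladder_const N X > 0 \<and>
    (\<forall>i. ladder_law N M X i =
           1 / ladder_const N X * pmf \<pi> i * \<P>(\<omega> in prob_from N M i. dual_epoch X 1 \<omega> = \<infinity>) \<and>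
         ladder_law N M X i =
           1 / ladder_const N X *
             prob_init N M \<pi> (\<lambda>\<omega>. dual_ladder_chain M X 0 \<omega> = i \<and> dual_epoch X 1 \<omega> = \<infinity>)) \<and>
    ladder_const N X = prob_init N M \<pi> (\<lambda>\<omega>. dual_epoch X 1 \<omega> = \<infinity>) \<and>
    {i. ladder_law N M X i > 0} = {i. \<P>(\<omega> in prob_from N M i. dual_epoch X 1 \<omega> = \<infinity>) > 0}"
proof -
  let ?E = "count_space UNIV \<Otimes>\<^sub>M borel :: ('s \<times> real) measure"
  have st: "stationary_process N ?E (\<lambda>n \<omega>. (M n \<omega>, X n \<omega>))"
    and mrw: "markov_random_walk P F N (\<lambda>n. M (int n)) (\<lambda>n. X (int n))"
    using assms(5) by (auto simp: stationary_mrw_def)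
  then have mc: "markov_chain P N (\<lambda>n. M (int n))" and N: "prob_space N"
    by (auto simp: markov_random_walk_def)
  interpret prob_space N by (rule N)
  have Z: "(\<lambda>\<omega>. (M n \<omega>, X n \<omega>)) \<in> measurable N ?E" for n
    using st by (simp add: stationary_process_def)
  have M_meas [measurable]: "M n \<in> measurable N (count_space UNIV)" for n
    using measurable_compose[OF Z[of n] measurable_fst] by simp
  have [measurable]: "X n \<in> borel_measurable N" for n
    using measurable_compose[OF Z[of n] measurable_snd] by simp
  have [measurable]: "dual_walk X (int k) \<in> borel_measurable N" for k
    by (subst dual_walk_int[abs_def]) simp
  have [measurable]: "walk X n \<in> borel_measurable N" for n
    unfolding walk_def[abs_def] by simp
  have inv: "distr N (count_space UNIV) (M (int 1)) = distr N (count_space UNIV) (M (int 0))"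
  proof (rule measure_eqI)
    fix A assume "A \<in> sets (distr N (count_space UNIV) (M (int 1)))"
    define B where "B = {z \<in> space (\<Pi>\<^sub>M n\<in>(UNIV::int set). ?E). fst (z 0) \<in> A}"
    have B: "B \<in> sets (\<Pi>\<^sub>M n\<in>UNIV. ?E)"
      unfolding B_def by measurable
    have "measure N (M 1 -` A \<inter> space N) = measure N (M 0 -` A \<inter> space N)"
      using stationary_process_prob_shift[OF st B, of 1]
      by (simp add: B_def space_PiM space_pair_measure vimage_def Int_def conj_commute)
    then show "emeasure (distr N (count_space UNIV) (M (int 1))) A = emeasure (distr N (count_space UNIV) (M (int 0))) A"
      by (simp add: emeasure_distr emeasure_eq_measure)
  qed simp
  have M0: "measure N {\<omega> \<in> space N. M 0 \<omega> = i} = pmf \<pi> i" for i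
    using markov_chain_initial_stationary[OF N assms(1,3) mc inv, of i] by simp
  have \<pi>_pos: "pmf \<pi> i > 0" for i
    by (rule stationary_distribution_pos[OF assms(1,3)])

  \<comment> \<open>Each state has positive mass, so the conditional statements become implications
    almost everywhere under \<open>N\<close>; countably many of them can be combined.\<close>
  have div: "AE \<omega> in N. filterlim (\<lambda>n. dual_walk X (int n) \<omega>) at_top sequentially"
  proof -
    have "AE \<omega> in N. M 0 \<omega> = i \<longrightarrow> filterlim (\<lambda>n. dual_walk X (int n) \<omega>) at_top sequentially" for i
    proof -
      have "AE \<omega> in uniform_measure N {\<omega> \<in> space N. M 0 \<omega> = i}.
          filterlim (\<lambda>n. dual_walk X (int n) \<omega>) at_top sequentially"
        using assms(6) unfolding dual_positive_divergent_def prob_from_def by blast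
      then have "AE \<omega> in N. \<omega> \<in> {\<omega> \<in> space N. M 0 \<omega> = i} \<longrightarrow>
          filterlim (\<lambda>n. dual_walk X (int n) \<omega>) at_top sequentially"
        by (subst (asm) AE_uniform_measure) (use \<pi>_pos[of i] M0[of i] in \<open>auto simp: emeasure_eq_measure\<close>)
      then show ?thesis
        using AE_space by eventually_elim simp
    qed
    then have "AE \<omega> in N. \<forall>i. M 0 \<omega> = i \<longrightarrow> filterlim (\<lambda>n. dual_walk X (int n) \<omega>) at_top sequentially"
      by (subst AE_all_countable) blast
    then show ?thesis by simp
  qed

  \<comment> \<open>Measurability is read off the characterizations, which involve only countably
    many values of the walk.\<close>
  have dual_meas [measurable]: "Measurable.pred N (\<lambda>\<omega>. dual_epoch X 1 \<omega> = \<infinity>)"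
    unfolding dual_epoch_1_eq_infinity_iff by measurable
  have sigma_meas [measurable]: "Measurable.pred N (\<lambda>\<omega>. sigma_zero X \<omega> = 0)"
    unfolding sigma_zero_eq_0_iff by measurable
  have sigma_dual: "AE \<omega> in N. sigma_zero X \<omega> = 0 \<longleftrightarrow> dual_epoch X 1 \<omega> = \<infinity>"
    using div by eventually_elim (rule sigma_zero_eq_0_iff_dual_epoch)

  let ?q = "\<lambda>i. \<P>(\<omega> in N. M 0 \<omega> = i \<and> dual_epoch X 1 \<omega> = \<infinity>)"
  have c: "ladder_const N X = \<P>(\<omega> in N. dual_epoch X 1 \<omega> = \<infinity>)"
    unfolding ladder_const_def using sigma_dual by (intro prob_eq_AE) (auto simp del: One_nat_def)
  have law: "ladder_law N M X i = 1 / ladder_const N X * ?q i" for i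
  proof -
    have "\<P>(\<omega> in N. M 0 \<omega> = i \<and> sigma_zero X \<omega> = 0) = ?q i"
      using sigma_dual by (intro prob_eq_AE) (auto simp del: One_nat_def)
    then show ?thesis by (simp add: ladder_law_def)
  qed
  \<comment> \<open>With a zero constant, \<open>1 / ladder_const N X\<close> would be 0 by
    convention and \<open>ladder_law\<close> would vanish identically.\<close>
  have c_pos: "ladder_const N X > 0"
    unfolding c by (rule prob_dual_epoch_infinity_pos[OF N st div])

  have from_eq: "pmf \<pi> i * \<P>(\<omega> in prob_from N M i. A \<omega>) = \<P>(\<omega> in N. M 0 \<omega> = i \<and> A \<omega>)"
    if [measurable]: "Measurable.pred N A" for A i
  proof -
    have "\<P>(\<omega> in prob_from N M i. A \<omega>) =
        measure N ({\<omega> \<in> space N. M 0 \<omega> = i} \<inter> {\<omega> \<in> space N. A \<omega>}) / measure N {\<omega> \<in> space N. M 0 \<omega> = i}"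
      unfolding prob_from_def space_uniform_measure
      by (rule measure_uniform_measure) (use \<pi>_pos[of i] M0[of i] in \<open>auto simp: emeasure_eq_measure\<close>)
    also have "{\<omega> \<in> space N. M 0 \<omega> = i} \<inter> {\<omega> \<in> space N. A \<omega>} = {\<omega> \<in> space N. M 0 \<omega> = i \<and> A \<omega>}"
      by auto
    finally show ?thesis
      using \<pi>_pos[of i] by (simp add: M0)
  qed

  \<comment> \<open>Total probability over the state at time 0, first as an \<open>ennreal\<close>
    sum; finiteness then gives the absolute summability that links it to the \<open>infsum\<close>
    in \<open>prob_init\<close>.\<close>
  have init_eq: "prob_init N M \<pi> A = \<P>(\<omega> in N. A \<omega>)"
    if A [measurable]: "Measurable.pred N A" for A
  proof -
    have "{\<omega> \<in> space N. A \<omega>} = (\<Union>i. {\<omega> \<in> space N. M 0 \<omega> = i \<and> A \<omega>})"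
      by auto
    also have "emeasure N \<dots> = (\<integral>\<^sup>+i. emeasure N {\<omega> \<in> space N. M 0 \<omega> = i \<and> A \<omega>} \<partial>count_space UNIV)"
      by (intro emeasure_UN_countable) (auto simp: disjoint_family_on_def)
    finally have nn: "(\<integral>\<^sup>+i. ennreal (\<P>(\<omega> in N. M 0 \<omega> = i \<and> A \<omega>)) \<partial>count_space UNIV) =
        ennreal (\<P>(\<omega> in N. A \<omega>))"
      by (simp add: emeasure_eq_measure)
    then have "has_bochner_integral (count_space UNIV) (\<lambda>i. \<P>(\<omega> in N. M 0 \<omega> = i \<and> A \<omega>)) (\<P>(\<omega> in N. A \<omega>))"
      by (intro has_bochner_integral_nn_integral) auto
    then have int: "integrable (count_space UNIV) (\<lambda>i. \<P>(\<omega> in N. M 0 \<omega> = i \<and> A \<omega>))"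
      and val: "integral\<^sup>L (count_space UNIV) (\<lambda>i. \<P>(\<omega> in N. M 0 \<omega> = i \<and> A \<omega>)) = \<P>(\<omega> in N. A \<omega>)"
      by (auto simp: has_bochner_integral_iff)
    have "(\<Sum>\<^sub>\<infinity>i. \<P>(\<omega> in N. M 0 \<omega> = i \<and> A \<omega>)) = (\<Sum>\<^sub>ai. \<P>(\<omega> in N. M 0 \<omega> = i \<and> A \<omega>))"
      using int by (intro infsetsum_infsum[symmetric]) (simp add: abs_summable_on_def)
    then show ?thesis
      using val by (simp add: prob_init_def from_eq[OF A] infsetsum_def)
  qed
  \<comment> \<open>The zeroth epoch is 0 on every path, so \<open>the_enat\<close> is evaluated at
    a finite value here.\<close>
  have ladder0: "dual_ladder_chain M X 0 \<omega> = M 0 \<omega>" for \<omega>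
    by (simp add: dual_ladder_chain_def dual_chain_def dual_epoch_def zero_enat_def)
  have "prob_init N M \<pi> (\<lambda>\<omega>. dual_ladder_chain M X 0 \<omega> = i \<and> dual_epoch X 1 \<omega> = \<infinity>) = ?q i" for i
    unfolding ladder0 by (rule init_eq) measurable
  moreover have q_eq: "pmf \<pi> i * \<P>(\<omega> in prob_from N M i. dual_epoch X 1 \<omega> = \<infinity>) = ?q i" for i
    by (rule from_eq[OF dual_meas])
  moreover have "ladder_law N M X i > 0 \<longleftrightarrow> \<P>(\<omega> in prob_from N M i. dual_epoch X 1 \<omega> = \<infinity>) > 0" for i
    unfolding law q_eq[symmetric] using c_pos \<pi>_pos[of i]
    by (simp add: zero_less_mult_iff zero_less_divide_iff)
  ultimately show ?thesis
    using c_pos law c init_eq[OF dual_meas] by (simp add: mult.assoc)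
qed

end
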